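(* Let $\mathcal{H}_n$ denote the $n$-dimensional hypercube, let $\mathrm{tw}_n$ denote the treewidth of $\mathcal{H}_n$, and let $N_n := 2^{2n-1} + n2^n$. There exists no family $(C_n)_{n \in \mathbb{N}}$, where each $C_n$ is an XOR-circuit over $\mathcal{H}_n$, such that all of the following hold: (1) there is a polynomial $p$ with $|V_{C_n}| \le p(N_n)$ for all $n$; (2) for every $n$, every automorphism $\pi \in \mathrm{Aut}(\mathcal{H}_n)$ extends to an automorphism of $C_n$ (i.e. the $\mathrm{Aut}(\mathcal{H}_n)$-orbit of $C_n$ under relabelling of input gates has size exactly one); (3) there is a constant $c>0$ such that for all sufficiently large $n$, $C_n$ is sensitive to at least $c\cdot \mathrm{tw}_n$ input gates; (4) there is a constant $K$ such that for all sufficiently large $n$, for any two gates $g,h$ of $C_n$ such that $h$ is a parent of $g$, both $|\mathrm{Orbit}_{(h)}(g)| \le K \log N_n$ and $|\mathrm{Orbit}_{(g)}(h)| \le K\log N_n$.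
   Context: The $n$-dimensional hypercube $\mathcal{H}_n$ is the undirected graph with vertex set $\{0,1\}^n$ in which two strings are adjacent iff their Hamming distance is exactly one; $E(\mathcal{H}_n)$ is its edge set and $\mathrm{Aut}(\mathcal{H}_n)$ its automorphism group, acting on edges via $\{u,v\}\mapsto\{\pi(u),\pi(v)\}$. The number $N_n = 2^{2n-1}+n2^n$ is the number of vertices of a Cai–Fürer–Immerman (CFI) graph over $\mathcal{H}_n$ (each vertex $v$ replaced by $2^{n-1}$ vertices, each edge by $2$ vertices). An XOR-circuit over $\mathcal{H}_n$ is a finite connected directed acyclic graph $C=(V_C,E_C)$ with a unique designated root $r$; a wire $(g,h)\in E_C$ means that the output of $h$ is an input of $g$ ($h$ is a child of $g$, $g$ a parent of $h$). The leaves are input gates and carry an injective labelling $\ell$ from the set of leaves into $E(\mathcal{H}_n)$; every internal gate computes the XOR (sum mod 2) of the values of its children; the output of the circuit is the value of $r$. For an input assignment (one bit per input gate), $C$ is sensitive to an input gate $g$ if flipping the bit of $g$ changes the output value (this does not depend on the assignment). A permutation $\pi\in\mathrm{Aut}(\mathcal{H}_n)$ extends to an automorphism $\sigma$ of $C$ if $\sigma$ is an automorphism of the directed graph $(V_C,E_C)$ with $\ell(\sigma(g))=\pi(\ell(g))$ for every input gate $g$. For gates $g,h$, $\mathrm{Orbit}_{(h)}(g) := \{\sigma(g) \mid \sigma$ an automorphism of $C$ to which some $\pi\in\mathrm{Aut}(\mathcal{H}_n)$ extends, with $\sigma(h)=h\}$, and symmetrically $\mathrm{Orbit}_{(g)}(h)$.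 *)

theory Defs
  imports
    Complex_Main
    "HOL-Combinatorics.Permutations"
    "HOL-Computational_Algebra.Polynomial"
    "Graph_Theory.Graph_Theory"
begin

text \<open>
  Digraphs are pair digraphs; undirected simple graphs are, as usual in \<^theory>\<open>Graph_Theory.Digraph\<close>,
  symmetric loop-free pair digraphs. The name \<open>connected\<close> is qualified because
  it also names the topological notion.
\<close>

definition graph_edges :: "'a pair_pre_digraph \<Rightarrow> 'a set set" where
  "graph_edges G = {{u, v} | u v. (u, v) \<in> parcs G}"

definition Aut :: "'a pair_pre_digraph \<Rightarrow> ('a \<Rightarrow> 'a) set" where
  "Aut G = {\<pi>. \<pi> permutes pverts G \<and>
     (\<forall>u \<in> pverts G. \<forall>v \<in> pverts G. (u, v) \<in> parcs G \<longleftrightarrow> (\<pi> u, \<pi> v) \<in> parcs G)}"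


section \<open>Hypercubes\<close>

definition hamming_dist :: "bool list \<Rightarrow> bool list \<Rightarrow> nat" where
  "hamming_dist u v = card {i. i < length u \<and> u ! i \<noteq> v ! i}"

definition hypercube :: "nat \<Rightarrow> bool list pair_pre_digraph" where
  "hypercube n =
     \<lparr> pverts = {u. length u = n},
       parcs = {(u, v). length u = n \<and> length v = n \<and> hamming_dist u v = 1} \<rparr>"

definition cfi_size :: "nat \<Rightarrow> nat" where
  "cfi_size n = 2 ^ (2 * n - 1) + n * 2 ^ n"


section \<open>Treewidth\<close>

text \<open>
  The predicate \<open>tree\<close> of \<^theory>\<open>Graph_Theory.Digraph_Component\<close> only forbids directed cycles. In a symmetric
  digraph every edge is a directed cycle of length 2, and the cycles of length at least 3 are exactly
  the cycles of the undirected graph.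
\<close>

definition undirected_tree :: "'t pair_pre_digraph \<Rightarrow> bool" where
  "undirected_tree T \<longleftrightarrow>
     pair_graph T \<and>
     Digraph_Component.connected (with_proj T) \<and>
     \<not> (\<exists>p. pre_digraph.cycle (with_proj T) p \<and> length p \<ge> 3)"

definition tree_decomposition ::
    "'a pair_pre_digraph \<Rightarrow> 't pair_pre_digraph \<Rightarrow> ('t \<Rightarrow> 'a set) \<Rightarrow> bool" where
  "tree_decomposition G T bag \<longleftrightarrow>
     undirected_tree T \<and>
     (\<Union>t \<in> pverts T. bag t) = pverts G \<and>
     (\<forall>e \<in> graph_edges G. \<exists>t \<in> pverts T. e \<subseteq> bag t) \<and>
     (\<forall>v \<in> pverts G. Digraph_Component.connected (with_proj T \<restriction> {t \<in> pverts T. v \<in> bag t}))"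

definition decomposition_width :: "'t pair_pre_digraph \<Rightarrow> ('t \<Rightarrow> 'a set) \<Rightarrow> nat" where
  "decomposition_width T bag = Max ((\<lambda>t. card (bag t)) ` pverts T) - 1"

text \<open>The trees are finite, so tree nodes may be taken to be natural numbers.\<close>

definition treewidth :: "'a pair_pre_digraph \<Rightarrow> nat" where
  "treewidth G = (LEAST w. \<exists>(T :: nat pair_pre_digraph) bag.
     tree_decomposition G T bag \<and> decomposition_width T bag = w)"


section \<open>XOR-circuits over hypercubes\<close>

record 'g circuit =
  dag :: "'g pair_pre_digraph"
  root :: 'g
  label :: "'g \<Rightarrow> bool list set"

abbreviation gates :: "'g circuit \<Rightarrow> 'g set" where
  "gates C \<equiv> pverts (dag C)"

text \<open>A wire \<open>(g, h)\<close> leads from the parent \<open>g\<close> to the child \<open>h\<close>.\<close>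

abbreviation wires :: "'g circuit \<Rightarrow> ('g \<times> 'g) set" where
  "wires C \<equiv> parcs (dag C)"

definition input_gates :: "'g circuit \<Rightarrow> 'g set" where
  "input_gates C = {g \<in> gates C. \<forall>h. (g, h) \<notin> wires C}"

text \<open>
  The root is the unique gate without parents. There is no such circuit over the 0-dimensional
  hypercube: a finite nonempty dag has a leaf, and that graph has no edge to label it with.
\<close>

definition xor_circuit :: "nat \<Rightarrow> 'g circuit \<Rightarrow> bool" where
  "xor_circuit n C \<longleftrightarrow>
     pair_fin_digraph (dag C) \<and>
     Digraph_Component.connected (with_proj (dag C)) \<and>
     acyclic (wires C) \<and>
     {g \<in> gates C. \<forall>h. (h, g) \<notin> wires C} = {root C} \<and>
     inj_on (label C) (input_gates C) \<and>
     label C ` input_gates C \<subseteq> graph_edges (hypercube n)"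

definition gate_value :: "'g circuit \<Rightarrow> ('g \<Rightarrow> bool) \<Rightarrow> 'g \<Rightarrow> bool" where
  "gate_value C a = wfrec ((wires C)\<inverse>)
     (\<lambda>val g. if g \<in> input_gates C then a g else odd (card {h. (g, h) \<in> wires C \<and> val h}))"

lemma gate_value_unfold:
  assumes "xor_circuit n C"
  shows "gate_value C a g =
    (if g \<in> input_gates C then a g
     else odd (card {h. (g, h) \<in> wires C \<and> gate_value C a h}))"
proof -
  have "finite (wires C)" and "acyclic (wires C)"
    using assms by (auto simp: xor_circuit_def pair_fin_digraph_def pair_fin_digraph_axioms_def)
  then have "wf ((wires C)\<inverse>)"
    by (simp add: finite_acyclic_wf_converse)
  then show ?thesis
    by (subst def_wfrec[OF gate_value_def[THEN eq_reflection]])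
       (auto simp: cut_def cong: conj_cong)
qed

definition circuit_output :: "'g circuit \<Rightarrow> ('g \<Rightarrow> bool) \<Rightarrow> bool" where
  "circuit_output C a = gate_value C a (root C)"

definition sensitive_to :: "'g circuit \<Rightarrow> 'g \<Rightarrow> bool" where
  "sensitive_to C g \<longleftrightarrow> g \<in> input_gates C \<and>
     (\<forall>a. circuit_output C (a(g := \<not> a g)) \<noteq> circuit_output C a)"

text \<open>A permutation of the vertices acts on an edge by taking its image.\<close>

definition extends_to :: "'g circuit \<Rightarrow> (bool list \<Rightarrow> bool list) \<Rightarrow> ('g \<Rightarrow> 'g) \<Rightarrow> bool" where
  "extends_to C \<pi> \<sigma> \<longleftrightarrow> \<sigma> \<in> Aut (dag C) \<and>
     (\<forall>g \<in> input_gates C. label C (\<sigma> g) = \<pi> ` label C g)"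

text \<open>\<open>orbit_fixing n C h g\<close> is the orbit of \<open>g\<close> under the automorphisms that fix \<open>h\<close>.\<close>

definition orbit_fixing :: "nat \<Rightarrow> 'g circuit \<Rightarrow> 'g \<Rightarrow> 'g \<Rightarrow> 'g set" where
  "orbit_fixing n C h g =
     {\<sigma> g | \<sigma>. (\<exists>\<pi> \<in> Aut (hypercube n). extends_to C \<pi> \<sigma>) \<and> \<sigma> h = h}"

end

theory Submission
  imports
    Defs
    "HOL-Combinatorics.Cycles"
    "HOL-Real_Asymp.Real_Asymp"
begin

text \<open>
  Take \<open>n = m + 1\<close> with \<open>m = 4 * q\<close> a power of two. By symmetry the circuit depends on every input
  as soon as it depends on one, in particular on the edge \<open>e\<close> at the origin in the last direction.
  The cyclic shift of the first \<open>m\<close> coordinates fixes \<open>e\<close> and extends to a circuit automorphism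
  \<open>\<sigma>\<close> of 2-power order. As a gate depending on \<open>e\<close> has an odd number of children depending on \<open>e\<close>,
  there is a path from the root to \<open>e\<close> all of whose gates are fixed by \<open>\<sigma>\<close>.

  For a gate \<open>g\<close> let \<open>W g\<close> be the space of translations of the first \<open>m\<close> coordinates that extend to
  an automorphism fixing \<open>g\<close>. It is everything at the root and trivial at \<open>e\<close>, and by the orbit
  bound its cardinality drops by a factor of at most \<open>O(n)\<close> per wire, so some \<open>g\<close> on the path has
  \<open>2 ^ q < card (W g) \<le> 2 ^ (2 * q)\<close>. A shift-invariant space of this size consists of vectors of
  period \<open>2 * q\<close> and separates the coordinates of one period. Hence no nontrivial permutation of the
  coordinates \<open>2 * q, ..., m - 1\<close> preserves \<open>W g\<close>, the orbit of \<open>g\<close> has at least \<open>(2 * q)!\<close> elements,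
  and this exceeds every polynomial in \<open>cfi_size n = 2 ^ O(n)\<close>.
\<close>

section \<open>Permutations of 2-power order\<close>

text \<open>Strong induction on the set removes one pair \<open>{x, f x}\<close> at a time.\<close>

lemma even_card_if_fixpoint_free_involution:
  assumes "finite S" and "\<And>x. x \<in> S \<Longrightarrow> f x \<in> S" and "\<And>x. x \<in> S \<Longrightarrow> f (f x) = x"
    and "\<And>x. x \<in> S \<Longrightarrow> f x \<noteq> x"
  shows "even (card S)"
  using assms
proof (induction S rule: finite_psubset_induct)
  case (psubset S)
  show ?case
  proof (cases "S = {}")
    case False
    then obtain x where x: "x \<in> S" by blast
    let ?R = "S - {x, f x}"
    have "f y \<in> ?R" if "y \<in> ?R" for y
      using that psubset.prems x by (metis Diff_iff insert_iff singletonD)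
    then have "even (card ?R)"
      using psubset.prems x by (intro psubset.IH) auto
    moreover have "card S = card ?R + 2"
    proof -
      have "{x, f x} \<subseteq> S" "card {x, f x} = 2"
        using psubset.prems(1)[OF x] psubset.prems(3)[OF x] x by (auto simp: card_insert_if)
      then show ?thesis
        using psubset.hyps by (metis card_Diff_subset card_mono finite_subset le_add_diff_inverse2)
    qed
    ultimately show ?thesis by simp
  qed simp
qed

text \<open>The power \<open>f ^^ (2 ^ a)\<close> is an involution on \<open>S\<close>, so the
  points it moves pair up and its fixed points form an odd set. As \<open>f\<close> commutes with
  its powers, it preserves this set, where the smaller exponent suffices.\<close>

lemma odd_card_fixpoint:
  assumes "finite S" and "odd (card S)" and "f ` S \<subseteq> S"
    and "\<And>x. x \<in> S \<Longrightarrow> (f ^^ (2 ^ a)) x = x"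
  shows "\<exists>x\<in>S. f x = x"
  using assms
proof (induction a arbitrary: S)
  case 0
  then have "S \<noteq> {}" by auto
  with 0 show ?case by auto
next
  case (Suc a)
  let ?g = "f ^^ (2 ^ a)"
  let ?F = "{x \<in> S. ?g x = x}"
  have closed: "(f ^^ i) x \<in> S" if "x \<in> S" for x i
    using that Suc.prems(3) by (induction i) auto
  have gg: "?g (?g x) = x" if "x \<in> S" for x
    using Suc.prems(4)[OF that] by (simp add: mult_2 funpow_add)
  have "even (card (S - ?F))"
  proof (rule even_card_if_fixpoint_free_involution[where f = ?g])
    show "?g x \<in> S - ?F" if "x \<in> S - ?F" for x
      using that closed gg by auto
  qed (use Suc.prems(1) gg in auto)
  moreover have "card S = card ?F + card (S - ?F)"
    using Suc.prems(1) by (subst card_Un_disjoint[symmetric]) (auto intro: arg_cong[where f = card])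
  ultimately have "odd (card ?F)"
    using Suc.prems(2) by simp
  moreover have "f ` ?F \<subseteq> ?F"
    using Suc.prems(3) by (auto simp: funpow_swap1[symmetric])
  ultimately have "\<exists>x\<in>?F. f x = x"
    using Suc.prems(1) by (intro Suc.IH) auto
  then show ?case by auto
qed

text \<open>Squaring \<open>1 + y\<close> gives \<open>1 + y * (y + 2)\<close>. The factor
  \<open>y\<close> contributes \<open>2 ^ k\<close>, and \<open>y + 2\<close> is even because powers
  of \<open>b\<close> are odd, which supplies one more factor 2.\<close>

lemma odd_power_two_power_cong_1:
  fixes b :: nat
  assumes "odd b"
  shows "\<exists>x. b ^ (2 ^ k) = 1 + 2 ^ k * x"
proof (induction k)
  case 0
  have "b > 0" using assms by (cases b) auto
  then show ?case by (intro exI[of _ "b - 1"]) simp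
next
  case (Suc k)
  then obtain x where x: "b ^ (2 ^ k) = 1 + 2 ^ k * x" by blast
  define y where "y = 2 ^ k * x"
  have b: "b ^ (2 ^ k) = 1 + y" using x by (simp add: y_def)
  moreover have "odd (b ^ (2 ^ k))" using assms by simp
  ultimately have "even (y + 2)" by simp
  then obtain z where z: "y + 2 = 2 * z" by blast
  have "b ^ (2 ^ Suc k) = (1 + y) * (1 + y)"
    using b by (simp add: mult_2 power_add)
  also have "\<dots> = 1 + y * (y + 2)" by (simp add: algebra_simps)
  also have "\<dots> = 1 + 2 ^ Suc k * (x * z)" unfolding z by (simp add: y_def)
  finally show ?case by blast
qed

text \<open>The exponent is a power of the odd part \<open>b\<close> of \<open>s\<close>, so it
  removes the odd part of the order. Being 1 modulo \<open>2 ^ k\<close>, it leaves any map whose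
  \<open>2 ^ k\<close>-th power is \<open>id\<close> unchanged.\<close>

lemma power_with_two_power_order:
  assumes "f ^^ s = id" and "s > 0"
  obtains r a where "\<exists>x. r = 1 + 2 ^ k * x" and "(f ^^ r) ^^ (2 ^ a) = id"
proof -
  obtain a b where s: "s = 2 ^ a * b" "odd b"
    using assms(2) by (metis multiplicity_decompose' two_is_prime_nat not_prime_unit gr_implies_not0)
  let ?r = "b ^ (2 ^ k)"
  have "b dvd ?r" by simp
  then obtain c where "?r * 2 ^ a = s * c"
    using s by (metis dvdE mult.assoc mult.commute)
  then have "(f ^^ ?r) ^^ (2 ^ a) = (f ^^ s) ^^ c"
    by (simp add: funpow_mult)
  then have "(f ^^ ?r) ^^ (2 ^ a) = id"
    using assms(1) by simp
  with odd_power_two_power_cong_1[OF s(2)] show ?thesis by (rule that)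
qed


section \<open>Rotation-invariant spaces of subsets\<close>

text \<open>It is the identity from \<open>m\<close> on, so it also acts on \<open>Suc m\<close>
  coordinates and fixes the last one.\<close>

definition cyc_shift :: "nat \<Rightarrow> nat \<Rightarrow> nat" where
  "cyc_shift m i = (if i < m then Suc i mod m else i)"

lemma funpow_cyc_shift: "i < m \<Longrightarrow> (cyc_shift m ^^ t) i = (i + t) mod m"
  by (induction t) (auto simp: cyc_shift_def mod_Suc_eq)

lemma cyc_shift_funpow_self: "cyc_shift m ^^ m = id"
proof
  fix i
  show "(cyc_shift m ^^ m) i = id i"
  proof (cases "i < m")
    case True
    then show ?thesis by (simp add: funpow_cyc_shift)
  next
    case False
    then have "(cyc_shift m ^^ t) i = i" for t
      by (induction t) (auto simp: cyc_shift_def)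
    then show ?thesis by simp
  qed
qed

lemma cyc_shift_permutes: "cyc_shift m permutes {..<m}"
proof -
  have "bij (cyc_shift m)"
  proof (cases m)
    case 0
    then have "cyc_shift m = id" by (auto simp: cyc_shift_def)
    then show ?thesis by simp
  next
    case (Suc l)
    have "cyc_shift m \<circ> cyc_shift m ^^ l = id" "cyc_shift m ^^ l \<circ> cyc_shift m = id"
      using cyc_shift_funpow_self[of m] by (simp_all add: Suc funpow_Suc_right del: funpow.simps(2) flip: funpow.simps(2))
    then show ?thesis by (rule o_bij[rotated])
  qed
  then have "\<exists>!i. cyc_shift m i = j" for j by (auto simp: bij_iff)
  then show ?thesis by (auto simp: permutes_def cyc_shift_def)
qed

text \<open>
  Subsets of \<open>{..<m}\<close> under symmetric difference form the vector space over the field with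
  two elements on which \<open>rotation_diff m\<close> acts as the cyclic shift minus the identity.
\<close>

definition rotation_diff :: "nat \<Rightarrow> nat set \<Rightarrow> nat set" where
  "rotation_diff m A = sym_diff (cyc_shift m -` A) A"

text \<open>These are the binary cyclic codes of length \<open>m\<close>, with words represented by
  their supports.\<close>

locale rotation_invariant_space =
  fixes m :: nat and W :: "nat set set"
  assumes subset_Pow: "W \<subseteq> Pow {..<m}"
    and empty_mem: "{} \<in> W"
    and sym_diff_mem: "\<lbrakk>A \<in> W; B \<in> W\<rbrakk> \<Longrightarrow> sym_diff A B \<in> W"
    and shift_mem: "A \<in> W \<Longrightarrow> cyc_shift m -` A \<in> W"
begin

lemma finite_space: "finite W"
  using subset_Pow by (rule finite_subset) simp

lemma rotation_diff_mem: "A \<in> W \<Longrightarrow> rotation_diff m A \<in> W"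
  by (simp add: rotation_diff_def sym_diff_mem shift_mem)

lemma funpow_cyc_shift_mem: "A \<in> W \<Longrightarrow> (cyc_shift m ^^ t) -` A \<in> W"
proof (induction t)
  case (Suc t)
  then have "cyc_shift m -` ((cyc_shift m ^^ t) -` A) \<in> W" by (intro shift_mem)
  then show ?case by (simp add: funpow_Suc_right vimage_def del: funpow.simps)
qed simp

lemma image_rotation_diff: "rotation_invariant_space m (rotation_diff m ` W)"
proof
  show "rotation_diff m ` W \<subseteq> Pow {..<m}"
    using rotation_diff_mem subset_Pow by blast
  show "{} \<in> rotation_diff m ` W"
    using empty_mem by (auto simp: rotation_diff_def image_iff intro!: bexI[of _ "{}"])
next
  fix A B
  assume "A \<in> rotation_diff m ` W" "B \<in> rotation_diff m ` W"
  then obtain A' B' where "A' \<in> W" "B' \<in> W" "A = rotation_diff m A'" "B = rotation_diff m B'"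
    by blast
  moreover have "sym_diff (rotation_diff m A') (rotation_diff m B') = rotation_diff m (sym_diff A' B')"
    by (auto simp: rotation_diff_def)
  ultimately show "sym_diff A B \<in> rotation_diff m ` W"
    using sym_diff_mem by blast
next
  fix A
  assume "A \<in> rotation_diff m ` W"
  then obtain A' where "A' \<in> W" "A = rotation_diff m A'" by blast
  moreover have "cyc_shift m -` rotation_diff m A' = rotation_diff m (cyc_shift m -` A')"
    by (auto simp: rotation_diff_def)
  ultimately show "cyc_shift m -` A \<in> rotation_diff m ` W"
    using shift_mem by blast
qed

end

text \<open>The Frobenius identity \<open>(x - 1)^(2^j) = x^(2^j) - 1\<close> in characteristic two.\<close>

lemma funpow_rotation_diff_two_power:
  "(rotation_diff m ^^ (2 ^ j)) A = sym_diff ((cyc_shift m ^^ (2 ^ j)) -` A) A"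
proof (induction j arbitrary: A)
  case 0
  then show ?case by (simp add: rotation_diff_def)
next
  case (Suc j)
  have "(rotation_diff m ^^ (2 ^ Suc j)) A = (rotation_diff m ^^ (2 ^ j)) ((rotation_diff m ^^ (2 ^ j)) A)"
    by (simp add: mult_2 funpow_add)
  also have "\<dots> = sym_diff ((cyc_shift m ^^ (2 ^ j)) -` (cyc_shift m ^^ (2 ^ j)) -` A) A"
    unfolding Suc by auto
  also have "(cyc_shift m ^^ (2 ^ j)) -` (cyc_shift m ^^ (2 ^ j)) -` A = (cyc_shift m ^^ (2 ^ Suc j)) -` A"
    by (simp add: mult_2 funpow_add vimage_comp)
  finally show ?case .
qed

text \<open>The hypothesis makes membership in \<open>A\<close> invariant under the shift, which is
  transitive on \<open>{..<m}\<close>.\<close>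

lemma rotation_diff_eq_empty_imp:
  assumes "A \<subseteq> {..<m}" and "rotation_diff m A = {}" and "A \<noteq> {}"
  shows "A = {..<m}"
proof -
  have step: "cyc_shift m i \<in> A \<longleftrightarrow> i \<in> A" for i
    using assms(2) by (auto simp: rotation_diff_def)
  then have iter: "(cyc_shift m ^^ t) i \<in> A \<longleftrightarrow> i \<in> A" for t i
    by (induction t) auto
  obtain a where a: "a \<in> A" "a < m" using assms(1,3) by blast
  have "i \<in> A" if "i < m" for i
  proof -
    \<comment> \<open>From \<open>a\<close>, the first \<open>m - a\<close> shifts lead around to 0
      and \<open>i\<close> more lead to \<open>i\<close>.\<close>
    have "(cyc_shift m ^^ (m - a + i)) a = i"
      using that a by (simp add: funpow_cyc_shift)
    then show ?thesis using iter a(1) by metis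
  qed
  then show ?thesis using assms(1) by blast
qed

context rotation_invariant_space
begin

text \<open>\<open>rotation_diff\<close> is nilpotent: its \<open>m\<close>-th iterate is the full
  rotation minus the identity. The last nonempty iterate of \<open>A\<close> lies in the kernel and
  must be \<open>{..<m}\<close>.\<close>

lemma all_mem:
  assumes "m = 2 ^ k" and "A \<in> W" and "A \<noteq> {}"
  shows "{..<m} \<in> W"
proof -
  have "(rotation_diff m ^^ m) A = {}"
    using funpow_rotation_diff_two_power[where m = m and j = k and A = A] assms(1) by (simp add: cyc_shift_funpow_self)
  then have "\<exists>t. (rotation_diff m ^^ t) A = {}" ..
  then obtain t where t: "(rotation_diff m ^^ t) A = {}" "\<And>i. i < t \<Longrightarrow> (rotation_diff m ^^ i) A \<noteq> {}"
    using exists_least_iff[of "\<lambda>t. (rotation_diff m ^^ t) A = {}"] by metis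
  then obtain s where s: "t = Suc s" using assms(3) by (cases t) auto
  let ?B = "(rotation_diff m ^^ s) A"
  have "?B \<in> W" by (induction s) (simp_all add: assms(2) rotation_diff_mem)
  moreover from this have "?B = {..<m}"
    using t s subset_Pow by (intro rotation_diff_eq_empty_imp) auto
  ultimately show ?thesis by simp
qed

text \<open>
  The kernel of \<open>rotation_diff\<close> on a nonzero space is \<open>{{}, {..<m}}\<close>, so every application
  halves the space.
\<close>

lemma card_image_rotation_diff:
  assumes "m = 2 ^ k" and "A \<in> W" and "A \<noteq> {}"
  shows "2 * card (rotation_diff m ` W) \<le> card W"
proof -
  have full: "{..<m} \<in> W" using all_mem assms .
  define c where "c B = {..<m} - B" for B
  have sub: "B \<subseteq> {..<m}" if "B \<in> W" for B using that subset_Pow by blast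
  have c_mem: "c B \<in> W" if "B \<in> W" for B
  proof -
    have "c B = sym_diff {..<m} B" using sub[OF that] by (auto simp: c_def)
    then show ?thesis using sym_diff_mem full that by simp
  qed
  have c_c: "c (c B) = B" if "B \<in> W" for B using sub[OF that] by (auto simp: c_def)
  have diff_c: "rotation_diff m (c B) = rotation_diff m B" if "B \<in> W" for B
  proof -
    have "cyc_shift m i < m \<longleftrightarrow> i < m" for i
      using permutes_in_image[OF cyc_shift_permutes, of m i] by simp
    then show ?thesis using sub[OF that] by (auto simp: c_def rotation_diff_def)
  qed
  have m: "0 < m" using assms(1) by simp
  \<comment> \<open>Complementation adds the kernel element \<open>{..<m}\<close> and swaps the two
    halves, so \<open>?W0\<close> meets every fibre of \<open>rotation_diff\<close>.\<close>
  let ?W0 = "{B \<in> W. 0 \<notin> B}" and ?W1 = "{B \<in> W. 0 \<in> B}"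
  have "bij_betw c ?W0 ?W1"
    by (rule bij_betwI[where g = c]) (auto simp: c_mem c_c, auto simp: c_def m)
  then have "card ?W0 = card ?W1" by (rule bij_betw_same_card)
  moreover have "card W = card ?W0 + card ?W1"
    using finite_space by (subst card_Un_disjoint[symmetric]) (auto intro: arg_cong[where f = card])
  moreover have "rotation_diff m ` W \<subseteq> rotation_diff m ` ?W0"
  proof
    fix X
    assume "X \<in> rotation_diff m ` W"
    then obtain B where B: "B \<in> W" "X = rotation_diff m B" by blast
    show "X \<in> rotation_diff m ` ?W0"
    proof (cases "0 \<in> B")
      case True
      then have "c B \<in> ?W0" using B c_mem by (simp add: c_def)
      then show ?thesis using B diff_c by (metis imageI)
    qed (use B in auto)
  qed
  then have "card (rotation_diff m ` W) \<le> card ?W0"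
    using finite_space by (intro surj_card_le) auto
  ultimately show ?thesis by simp
qed

end

text \<open>Each application at least halves a nonzero space, so after \<open>j\<close> of them only
  the empty set is left.\<close>

lemma funpow_rotation_diff_eq_empty:
  assumes "rotation_invariant_space m W" and "m = 2 ^ k" and "card W \<le> 2 ^ j" and "A \<in> W"
  shows "(rotation_diff m ^^ j) A = {}"
  using assms
proof (induction j arbitrary: W A)
  case 0
  then interpret rotation_invariant_space m W by simp
  have "card W \<le> Suc 0" using 0 by simp
  then have "A = {}"
    using finite_space empty_mem 0 by (auto simp: card_le_Suc0_iff_eq)
  then show ?case by simp
next
  case (Suc j)
  then interpret rotation_invariant_space m W by simp
  have "card (rotation_diff m ` W) \<le> 2 ^ j"
  proof (cases "W = {{}}")
    case False
    then obtain B where "B \<in> W" "B \<noteq> {}" using empty_mem by blast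
    from card_image_rotation_diff[OF Suc.prems(2) this] show ?thesis
      using Suc.prems(3) by simp
  qed simp
  then have "(rotation_diff m ^^ j) (rotation_diff m A) = {}"
    using Suc.prems by (intro Suc.IH[OF image_rotation_diff]) auto
  then show ?case by (simp add: funpow_swap1)
qed

section \<open>Periods of the members and separation of coordinates\<close>

lemma periodic_gcd:
  fixes f :: "nat \<Rightarrow> 'a"
  assumes "\<And>i. f (i + d) = f i" and "\<And>i. f (i + m) = f i" and "d > 0"
  shows "f (i + gcd d m) = f i"
proof -
  have mult: "f (i + p * x) = f i" if "\<And>i. f (i + p) = f i" for p x i
  proof (induction x)
    case (Suc x)
    then show ?case using that[of "i + p * x"] by (simp add: algebra_simps)
  qed simp
  \<comment> \<open>Bezout without subtraction: \<open>gcd d m\<close> steps and then a multiple of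
    \<open>m\<close> amount to a multiple of \<open>d\<close>.\<close>
  obtain x y where "d * x = m * y + gcd d m"
    using bezout_nat[of d m] assms(3) by auto
  then have "f (i + gcd d m + m * y) = f (i + d * x)" by (simp add: algebra_simps)
  then show ?thesis using mult[OF assms(1)] mult[OF assms(2)] by simp
qed

context rotation_invariant_space
begin

text \<open>By the cardinality bound the \<open>h\<close>-th iterate of \<open>rotation_diff\<close>
  vanishes on \<open>W\<close>. As \<open>h\<close> is a power of two, this iterate is the rotation
  by \<open>h\<close> minus the identity.\<close>

lemma half_period:
  assumes "m = 2 * h" and "h = 2 ^ k" and "card W \<le> 2 ^ h" and "A \<in> W" and "i < h"
  shows "i + h \<in> A \<longleftrightarrow> i \<in> A"
proof -
  have "(rotation_diff m ^^ h) A = {}"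
    using assms by (intro funpow_rotation_diff_eq_empty[OF rotation_invariant_space_axioms, of "Suc k"]) auto
  then have "(cyc_shift m ^^ h) i \<in> A \<longleftrightarrow> i \<in> A"
    using funpow_rotation_diff_two_power[where m = m and j = k and A = A] assms(2) by auto
  then show ?thesis using assms(1,5) by (simp add: funpow_cyc_shift)
qed

text \<open>If all members agreed at \<open>a\<close> and \<open>b\<close>, shift invariance would
  give each of them the cyclic period \<open>b - a\<close>, hence the period \<open>q\<close>. Then
  the first \<open>q\<close> coordinates would determine a member, leaving at most
  \<open>2 ^ q\<close> of them.\<close>

lemma separates:
  assumes m: "m = 4 * q" and q: "q = 2 ^ k" and card: "card W > 2 ^ q"
    and ab: "a < b" "b < a + 2 * q" "b < m"
  shows "\<exists>A\<in>W. (a \<in> A) \<noteq> (b \<in> A)"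
proof (rule ccontr)
  assume "\<not> ?thesis"
  then have eq: "a \<in> A \<longleftrightarrow> b \<in> A" if "A \<in> W" for A using that by blast
  define d where "d = b - a"
  have d: "0 < d" "d < 2 * q" "b = a + d" using ab by (auto simp: d_def)
  have period: "i mod m \<in> A \<longleftrightarrow> (i + q) mod m \<in> A" if A: "A \<in> W" for A i
  proof -
    let ?f = "\<lambda>i. i mod m \<in> A"
    have "?f (i + d) = ?f i" for i
    proof -
      \<comment> \<open>This many shifts carry \<open>a\<close> to \<open>i mod m\<close>. The
        summand \<open>m * a\<close> keeps the subtraction from truncating.\<close>
      define t where "t = i + m * a - a"
      have "a \<le> m * a" using ab by (cases m) auto
      then have t: "a + t = i + m * a" unfolding t_def by linarith
      have "(cyc_shift m ^^ t) a \<in> A \<longleftrightarrow> (cyc_shift m ^^ t) b \<in> A"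
        using eq[OF funpow_cyc_shift_mem[OF A, of t]] by simp
      moreover have "(cyc_shift m ^^ t) a = i mod m"
        using ab t by (simp add: funpow_cyc_shift)
      moreover have "(cyc_shift m ^^ t) b = (i + d) mod m"
      proof -
        have "b + t = i + d + m * a" using t d by simp
        then show ?thesis using ab by (simp add: funpow_cyc_shift)
      qed
      ultimately show ?thesis by simp
    qed
    then have gcd: "?f (i + gcd d m) = ?f i" for i
      using d(1) by (intro periodic_gcd) auto
    \<comment> \<open>The gcd divides a power of two, so it is one itself; being less than
      \<open>2 * q = 2 ^ Suc k\<close>, it divides \<open>q\<close>.\<close>
    have "m = 2 ^ (k + 2)" using m q by simp
    then obtain j where j: "gcd d m = 2 ^ j"
      using divides_primepow_nat[OF two_is_prime_nat, of "gcd d m" "k + 2"] by auto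
    moreover have "gcd d m \<le> d" using d(1) by simp
    ultimately have "(2::nat) ^ j < 2 ^ Suc k" using d(2) q by simp
    then have "j < Suc k" by (rule power_less_imp_less_exp[rotated]) simp
    then have "j \<le> k" by simp
    then obtain c where c: "q = gcd d m * c" using j q by (metis le_imp_power_dvd dvdE)
    have "?f (i + gcd d m * x) = ?f i" for x
    proof (induction x)
      case (Suc x)
      then show ?case using gcd[of "i + gcd d m * x"] by (simp add: algebra_simps)
    qed simp
    then show ?thesis using c by simp
  qed
  \<comment> \<open>A member of period \<open>q\<close> is recovered from its trace on
    \<open>{..<q}\<close> by going down in steps of \<open>q\<close>.\<close>
  have "inj_on (\<lambda>A. A \<inter> {..<q}) W"
  proof (rule inj_onI)
    fix A B
    assume A: "A \<in> W" and B: "B \<in> W" and AB: "A \<inter> {..<q} = B \<inter> {..<q}"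
    have "i mod m \<in> A \<longleftrightarrow> i mod m \<in> B" for i
    proof (induction i rule: less_induct)
      case (less i)
      show ?case
      proof (cases "i < q")
        case True
        then have "i \<in> A \<inter> {..<q} \<longleftrightarrow> i \<in> B \<inter> {..<q}" "i mod m = i" using AB m by simp_all
        then show ?thesis using True by simp
      next
        case False
        have "0 < q" using q by simp
        with False have "i - q < i" by linarith
        then have "(i - q) mod m \<in> A \<longleftrightarrow> (i - q) mod m \<in> B" by (rule less)
        then show ?thesis using False period[OF A, of "i - q"] period[OF B, of "i - q"] by simp
      qed
    qed
    then have "i \<in> A \<longleftrightarrow> i \<in> B" if "i < m" for i using that by (metis mod_less)
    then show "A = B" using A B subset_Pow by (auto simp: subset_iff)
  qed
  moreover have "(\<lambda>A. A \<inter> {..<q}) ` W \<subseteq> Pow {..<q}" by blast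
  ultimately have "card W \<le> card (Pow {..<q})" by (intro card_inj_on_le) auto
  then show False using card by (simp add: card_Pow)
qed

text \<open>
  In the given range of cardinalities, the coordinates on which all members of \<open>W\<close> agree are
  exactly the pairs \<open>{i, i + 2 * q}\<close>, and a permutation of the upper half breaks this matching.
\<close>

lemma upper_half_stabilizer_trivial:
  assumes m: "m = 4 * q" and q: "q = 2 ^ k" and card: "2 ^ q < card W" "card W \<le> 2 ^ (2 * q)"
    and \<rho>: "\<rho> permutes {2 * q..<m}" and inv: "\<And>A. A \<in> W \<Longrightarrow> \<rho> -` A \<in> W"
  shows "\<rho> = id"
proof -
  have "\<rho> b = b" if b: "b \<in> {2 * q..<m}" for b
  proof -
    obtain a where a: "b = a + 2 * q" "a < 2 * q"
      using b m by (auto simp: le_iff_add)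
    have pair: "b \<in> A \<longleftrightarrow> a \<in> A" if "A \<in> W" for A
      using half_period[of "2 * q" "Suc k" A a] that m q card a by simp
    \<comment> \<open>The matching is applied to \<open>A\<close> and to its preimage under
      \<open>\<rho>\<close>; as \<open>a\<close> stays put, \<open>A\<close> cannot tell
      \<open>\<rho> b\<close> from \<open>b\<close>.\<close>
    have "\<rho> a = a" using \<rho> a(2) by (intro permutes_not_in) auto
    then have same: "\<rho> b \<in> A \<longleftrightarrow> b \<in> A" if "A \<in> W" for A
      using pair[OF that] pair[OF inv[OF that]] by simp
    have \<rho>b: "\<rho> b \<in> {2 * q..<m}" using permutes_in_image[OF \<rho>] b by simp
    show ?thesis
    proof (rule ccontr)
      assume "\<rho> b \<noteq> b"
      \<comment> \<open>Both indices lie in \<open>{2 * q..<4 * q}\<close> and so are less than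
        \<open>2 * q\<close> apart, as \<open>separates\<close> demands.\<close>
      then consider "\<rho> b < b" | "b < \<rho> b" by linarith
      then show False
      proof cases
        case 1
        then show False using separates[OF m q card(1) 1] same b \<rho>b m by auto
      next
        case 2
        then show False using separates[OF m q card(1) 2] same b \<rho>b m by auto
      qed
    qed
  qed
  then show ?thesis
    using \<rho> by (metis eq_id_iff permutes_not_in)
qed

end


section \<open>Automorphisms of the hypercube\<close>

lemma Aut_id: "id \<in> Aut G"
  by (simp add: Aut_def)

lemma Aut_comp:
  assumes "\<pi> \<in> Aut G" and "\<pi>' \<in> Aut G"
  shows "\<pi> \<circ> \<pi>' \<in> Aut G"
proof -
  have \<pi>: "\<pi> permutes pverts G" "\<pi>' permutes pverts G" using assms by (simp_all add: Aut_def)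
  have "\<pi>' u \<in> pverts G" if "u \<in> pverts G" for u
    using permutes_in_image[OF \<pi>(2)] that by blast
  then show ?thesis
    using assms permutes_compose[OF \<pi>(2,1)] by (simp add: Aut_def)
qed

lemma Aut_inv:
  assumes "\<pi> \<in> Aut G"
  shows "inv \<pi> \<in> Aut G"
proof -
  have \<pi>: "\<pi> permutes pverts G" using assms by (simp add: Aut_def)
  have "(u, v) \<in> parcs G \<longleftrightarrow> (inv \<pi> u, inv \<pi> v) \<in> parcs G" if "u \<in> pverts G" "v \<in> pverts G" for u v
  proof -
    have "inv \<pi> u \<in> pverts G" "inv \<pi> v \<in> pverts G"
      using permutes_in_image[OF permutes_inv[OF \<pi>]] that by auto
    then have "(inv \<pi> u, inv \<pi> v) \<in> parcs G \<longleftrightarrow> (\<pi> (inv \<pi> u), \<pi> (inv \<pi> v)) \<in> parcs G"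
      using assms by (simp add: Aut_def)
    then show ?thesis by (simp add: permutes_inverses[OF \<pi>])
  qed
  then show ?thesis using permutes_inv[OF \<pi>] by (simp add: Aut_def)
qed

lemma Aut_bij: "\<pi> \<in> Aut G \<Longrightarrow> bij \<pi>"
  by (auto simp: Aut_def intro: permutes_bij)

section \<open>Coordinate flips and coordinate permutations\<close>

definition flip_bits :: "nat \<Rightarrow> nat set \<Rightarrow> bool list \<Rightarrow> bool list" where
  "flip_bits n A u = (if length u = n then map (\<lambda>i. u ! i \<noteq> (i \<in> A)) [0..<n] else u)"

text \<open>Position \<open>i\<close> reads the entry at \<open>\<rho> i\<close>, so composition
  reverses the order of the permutations. Like \<open>flip_bits\<close>, this is the identity on
  lists of other lengths, because \<open>Aut\<close> asks for \<open>permutes\<close>.\<close>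

definition permute_bits :: "nat \<Rightarrow> (nat \<Rightarrow> nat) \<Rightarrow> bool list \<Rightarrow> bool list" where
  "permute_bits n \<rho> u = (if length u = n then map (\<lambda>i. u ! \<rho> i) [0..<n] else u)"

lemma length_flip_bits [simp]: "length (flip_bits n A u) = length u"
  by (simp add: flip_bits_def)

lemma length_permute_bits [simp]: "length (permute_bits n \<rho> u) = length u"
  by (simp add: permute_bits_def)

lemma nth_flip_bits [simp]:
  "\<lbrakk>length u = n; i < n\<rbrakk> \<Longrightarrow> flip_bits n A u ! i = (u ! i \<noteq> (i \<in> A))"
  by (simp add: flip_bits_def)

lemma nth_permute_bits [simp]:
  "\<lbrakk>length u = n; i < n\<rbrakk> \<Longrightarrow> permute_bits n \<rho> u ! i = u ! \<rho> i"
  by (simp add: permute_bits_def)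

lemma flip_bits_comp: "flip_bits n A \<circ> flip_bits n B = flip_bits n (sym_diff A B)"
proof
  fix u
  show "(flip_bits n A \<circ> flip_bits n B) u = flip_bits n (sym_diff A B) u"
  proof (cases "length u = n")
    case True
    then show ?thesis by (intro nth_equalityI) auto
  qed (simp add: flip_bits_def)
qed

lemma flip_bits_empty: "flip_bits n {} = id"
proof
  fix u
  show "flip_bits n {} u = id u"
  proof (cases "length u = n")
    case True
    then show ?thesis by (intro nth_equalityI) auto
  qed (simp add: flip_bits_def)
qed

lemma inv_flip_bits: "inv (flip_bits n A) = flip_bits n A"
  using flip_bits_comp[of n A A] by (intro inv_unique_comp) (simp_all add: flip_bits_empty)

lemma permute_bits_id: "permute_bits n id = id"
proof
  fix u
  show "permute_bits n id u = id u"
  proof (cases "length u = n")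
    case True
    then show ?thesis by (intro nth_equalityI) auto
  qed (simp add: permute_bits_def)
qed

lemma permute_bits_comp:
  assumes "\<rho> permutes {..<n}"
  shows "permute_bits n \<rho> \<circ> permute_bits n \<rho>' = permute_bits n (\<rho>' \<circ> \<rho>)"
proof
  fix u
  show "(permute_bits n \<rho> \<circ> permute_bits n \<rho>') u = permute_bits n (\<rho>' \<circ> \<rho>) u"
  proof (cases "length u = n")
    case True
    moreover have "\<rho> i < n" if "i < n" for i
      using permutes_in_image[OF assms, of i] that by simp
    ultimately show ?thesis by (intro nth_equalityI) auto
  qed (simp add: permute_bits_def)
qed

lemma inv_permute_bits:
  assumes "\<rho> permutes {..<n}"
  shows "inv (permute_bits n \<rho>) = permute_bits n (inv \<rho>)"
proof -
  have "permute_bits n \<rho> \<circ> permute_bits n (inv \<rho>) = id"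
    using permute_bits_comp[OF assms] by (simp add: permutes_inv_o[OF assms] permute_bits_id)
  moreover have "permute_bits n (inv \<rho>) \<circ> permute_bits n \<rho> = id"
    using permute_bits_comp[OF permutes_inv[OF assms]]
    by (simp add: permutes_inv_o[OF assms] permute_bits_id)
  ultimately show ?thesis by (rule inv_unique_comp)
qed

lemma funpow_permute_bits:
  assumes "\<rho> permutes {..<n}"
  shows "permute_bits n \<rho> ^^ t = permute_bits n (\<rho> ^^ t)"
proof (induction t)
  case (Suc t)
  then have "permute_bits n \<rho> ^^ Suc t = permute_bits n (\<rho> ^^ t \<circ> \<rho>)"
    by (simp add: permute_bits_comp[OF assms])
  then show ?case by (simp only: funpow_Suc_right)
qed (simp add: permute_bits_id[unfolded id_def] id_def)

text \<open>Position \<open>i\<close> reads position \<open>\<rho> i\<close>, which was flipped iff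
  \<open>\<rho> i\<close> is in \<open>A\<close>. Conjugation by coordinate permutations thus acts
  on flips by preimages.\<close>

lemma permute_bits_flip_bits:
  assumes "\<rho> permutes {..<n}"
  shows "permute_bits n \<rho> \<circ> flip_bits n A = flip_bits n (\<rho> -` A) \<circ> permute_bits n \<rho>"
proof
  fix u
  show "(permute_bits n \<rho> \<circ> flip_bits n A) u = (flip_bits n (\<rho> -` A) \<circ> permute_bits n \<rho>) u"
  proof (cases "length u = n")
    case True
    moreover have "\<rho> i < n" if "i < n" for i
      using permutes_in_image[OF assms, of i] that by simp
    ultimately show ?thesis by (intro nth_equalityI) auto
  qed (simp add: permute_bits_def flip_bits_def)
qed

lemma Aut_hypercubeI:
  assumes "bij \<pi>" and "\<And>u. length u \<noteq> n \<Longrightarrow> \<pi> u = u"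
    and "\<And>u v. \<lbrakk>length u = n; length v = n\<rbrakk> \<Longrightarrow> hamming_dist (\<pi> u) (\<pi> v) = hamming_dist u v"
  shows "\<pi> \<in> Aut (hypercube n)"
proof -
  have "\<exists>!u. \<pi> u = v" for v using assms(1) by (auto simp: bij_iff)
  then have \<pi>: "\<pi> permutes {u. length u = n}" using assms(2) by (auto simp: permutes_def)
  then have "length (\<pi> u) = n" if "length u = n" for u
    using permutes_in_image[OF \<pi>, of u] that by simp
  then show ?thesis using \<pi> assms(3) by (auto simp: Aut_def hypercube_def)
qed

lemma flip_bits_Aut: "flip_bits n A \<in> Aut (hypercube n)"
proof (rule Aut_hypercubeI)
  have "flip_bits n A \<circ> flip_bits n A = id" by (simp add: flip_bits_comp flip_bits_empty)
  then show "bij (flip_bits n A)" using o_bij by blast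
qed (auto simp: flip_bits_def hamming_dist_def intro!: arg_cong[where f = card])

lemma permute_bits_Aut:
  assumes \<rho>: "\<rho> permutes {..<n}"
  shows "permute_bits n \<rho> \<in> Aut (hypercube n)"
proof (rule Aut_hypercubeI)
  have "permute_bits n \<rho> \<circ> permute_bits n (inv \<rho>) = id" "permute_bits n (inv \<rho>) \<circ> permute_bits n \<rho> = id"
    using permute_bits_comp[OF \<rho>] permute_bits_comp[OF permutes_inv[OF \<rho>]]
    by (simp_all add: permutes_inv_o[OF \<rho>] permute_bits_id)
  then show "bij (permute_bits n \<rho>)" using o_bij by blast
next
  fix u v :: "bool list"
  assume len: "length u = n" "length v = n"
  let ?D = "{i. i < length u \<and> u ! i \<noteq> v ! i}"
  have lt: "\<rho> i < n \<longleftrightarrow> i < n" for i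
    using permutes_in_image[OF \<rho>, of i] by simp
  have "{i. i < n \<and> permute_bits n \<rho> u ! i \<noteq> permute_bits n \<rho> v ! i} = \<rho> -` ?D"
    using len by (auto simp: lt)
  moreover have "card (\<rho> -` ?D) = card ?D"
    using permutes_bij[OF \<rho>] by (intro card_vimage_inj) (auto simp: bij_def)
  ultimately show "hamming_dist (permute_bits n \<rho> u) (permute_bits n \<rho> v) = hamming_dist u v"
    using len by (simp add: hamming_dist_def)
qed (simp add: permute_bits_def)

text \<open>The direction \<open>m\<close> is set apart so that permutations of
  \<open>{..<m}\<close> preserve this edge while nonempty flips inside \<open>{..<m}\<close> move
  it.\<close>

definition base_edge :: "nat \<Rightarrow> bool list set" where
  "base_edge m = {replicate (Suc m) False, (replicate (Suc m) False)[m := True]}"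

lemma hypercube_edge_transitive:
  assumes "e \<in> graph_edges (hypercube (Suc m))"
  obtains \<pi> where "\<pi> \<in> Aut (hypercube (Suc m))" and "\<pi> ` e = base_edge m"
proof -
  let ?n = "Suc m"
  obtain u v where uv: "e = {u, v}" "length u = ?n" "length v = ?n" "hamming_dist u v = 1"
    using assms by (auto simp: graph_edges_def hypercube_def)
  then obtain j where j: "{i. i < ?n \<and> u ! i \<noteq> v ! i} = {j}"
    by (auto simp: hamming_dist_def card_1_singleton_iff)
  define \<rho> where "\<rho> = transpose j m"
  have "j < ?n" using j by blast
  then have \<rho>: "\<rho> permutes {..<?n}" by (auto simp: \<rho>_def intro: permutes_swap_id)
  have \<rho>_lt: "\<rho> i < ?n" if "i < ?n" for i
    using permutes_in_image[OF \<rho>, of i] that by simp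
  \<comment> \<open>The flip takes \<open>u\<close> to the origin and \<open>v\<close> to the unit
    vector at \<open>j\<close>; the transposition then moves \<open>j\<close> to the last
    coordinate. Values of \<open>u ! i\<close> beyond the length do not matter, since
    \<open>flip_bits\<close> consults only indices below \<open>?n\<close>.\<close>
  define \<pi> where "\<pi> = permute_bits ?n \<rho> \<circ> flip_bits ?n {i. u ! i}"
  have "\<pi> \<in> Aut (hypercube ?n)"
    unfolding \<pi>_def by (intro Aut_comp permute_bits_Aut flip_bits_Aut \<rho>)
  moreover have "\<pi> u = replicate ?n False"
    using uv \<rho>_lt by (intro nth_equalityI) (auto simp: \<pi>_def simp del: replicate_Suc)
  moreover have "\<pi> v = (replicate ?n False)[m := True]"
  proof (rule nth_equalityI)
    fix i
    assume "i < length (\<pi> v)"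
    then have i: "i < ?n" using uv by (simp add: \<pi>_def)
    then have "\<pi> v ! i \<longleftrightarrow> \<rho> i = j"
      using uv j \<rho>_lt[OF i] by (auto simp: \<pi>_def)
    also have "\<dots> \<longleftrightarrow> i = m" by (auto simp: \<rho>_def transpose_def)
    finally show "\<pi> v ! i = (replicate ?n False)[m := True] ! i"
      using i by (simp add: nth_list_update del: replicate_Suc)
  qed (simp add: \<pi>_def uv del: replicate_Suc)
  ultimately show ?thesis using that uv(1) by (simp add: base_edge_def del: replicate_Suc)
qed

lemma base_edge_nth: "\<lbrakk>u \<in> base_edge m; i < m\<rbrakk> \<Longrightarrow> \<not> u ! i"
  by (auto simp: base_edge_def simp del: replicate_Suc)

text \<open>The image of the origin is an endpoint of the edge, and both endpoints vanish on the
  first \<open>m\<close> coordinates.\<close>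

lemma flip_bits_base_edge:
  assumes "A \<subseteq> {..<m}" and "flip_bits (Suc m) A ` base_edge m = base_edge m"
  shows "A = {}"
proof -
  let ?z = "replicate (Suc m) False"
  have "?z \<in> base_edge m" by (simp add: base_edge_def)
  then have "flip_bits (Suc m) A ?z \<in> base_edge m" using assms(2) by blast
  then have "\<not> flip_bits (Suc m) A ?z ! i" if "i < m" for i
    using base_edge_nth that by blast
  then have "i \<notin> A" if "i < m" for i
    using that by (simp del: replicate_Suc)
  then show ?thesis using assms(1) by blast
qed

lemma permute_bits_base_edge:
  assumes \<rho>: "\<rho> permutes {..<m}"
  shows "permute_bits (Suc m) \<rho> ` base_edge m = base_edge m"
proof -
  let ?z = "replicate (Suc m) False"
  have lt: "\<rho> i < Suc m" if "i < Suc m" for i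
    using permutes_in_image[OF permutes_subset[OF \<rho>, of "{..<Suc m}"], of i] that by auto
  have eq: "m = \<rho> i \<longleftrightarrow> m = i" for i
    using permutes_in_image[OF \<rho>, of i] permutes_not_in[OF \<rho>, of i] permutes_not_in[OF \<rho>, of m] by auto
  have "permute_bits (Suc m) \<rho> ?z = ?z"
    using lt by (intro nth_equalityI) (auto simp del: replicate_Suc)
  moreover have "permute_bits (Suc m) \<rho> (?z[m := True]) = ?z[m := True]"
    using lt eq by (intro nth_equalityI) (auto simp: nth_list_update simp del: replicate_Suc)
  ultimately show ?thesis by (simp add: base_edge_def del: replicate_Suc)
qed


section \<open>Symmetric circuits\<close>

locale symmetric_circuit =
  fixes m :: nat and C :: "'g circuit"
  assumes circuit: "xor_circuit (Suc m) C"
    and symmetric: "\<pi> \<in> Aut (hypercube (Suc m)) \<Longrightarrow> \<exists>\<sigma>. extends_to C \<pi> \<sigma>"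
begin

lemma wire_gates: "(g, h) \<in> wires C \<Longrightarrow> g \<in> gates C \<and> h \<in> gates C"
  using circuit
  by (force simp: xor_circuit_def pair_fin_digraph_def pair_wf_digraph_def)

lemma finite_gates: "finite (gates C)" and finite_wires: "finite (wires C)"
  using circuit
  by (auto simp: xor_circuit_def pair_fin_digraph_def pair_fin_digraph_axioms_def)

lemma wf_wires: "wf ((wires C)\<inverse>)"
  using circuit finite_wires by (simp add: xor_circuit_def finite_acyclic_wf_converse)

lemma root_gate: "root C \<in> gates C"
  using circuit by (auto simp: xor_circuit_def)

section \<open>Circuit automorphisms and gate values\<close>

context
  fixes \<sigma> :: "'g \<Rightarrow> 'g"
  assumes \<sigma>: "\<sigma> \<in> Aut (dag C)"
begin

lemma Aut_permutes_gates: "\<sigma> permutes gates C"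
  using \<sigma> by (simp add: Aut_def)

lemma Aut_gate_iff: "\<sigma> g \<in> gates C \<longleftrightarrow> g \<in> gates C"
  by (rule permutes_in_image[OF Aut_permutes_gates])

lemma Aut_wire_iff: "(\<sigma> g, \<sigma> h) \<in> wires C \<longleftrightarrow> (g, h) \<in> wires C"
proof (cases "g \<in> gates C \<and> h \<in> gates C")
  case True
  then show ?thesis using \<sigma> by (simp add: Aut_def)
next
  case False
  then show ?thesis using Aut_gate_iff wire_gates by blast
qed

lemma Aut_surj: obtains g where "h = \<sigma> g"
  using bij_is_surj[OF Aut_bij[OF \<sigma>]] by blast

lemma Aut_input_gate_iff: "\<sigma> g \<in> input_gates C \<longleftrightarrow> g \<in> input_gates C"
proof -
  have "(\<forall>h. (\<sigma> g, h) \<notin> wires C) \<longleftrightarrow> (\<forall>h. (g, h) \<notin> wires C)"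
    by (metis Aut_surj Aut_wire_iff)
  then show ?thesis by (simp add: input_gates_def Aut_gate_iff)
qed

lemma Aut_root: "\<sigma> (root C) = root C"
proof -
  have source: "{g \<in> gates C. \<forall>h. (h, g) \<notin> wires C} = {root C}"
    using circuit by (simp add: xor_circuit_def)
  have "(h, \<sigma> (root C)) \<notin> wires C" for h
  proof -
    obtain g where "h = \<sigma> g" by (rule Aut_surj)
    moreover have "(g, root C) \<notin> wires C" using source by blast
    ultimately show ?thesis by (simp add: Aut_wire_iff)
  qed
  then have "\<sigma> (root C) \<in> {g \<in> gates C. \<forall>h. (h, g) \<notin> wires C}"
    using root_gate by (simp add: Aut_gate_iff)
  then show ?thesis unfolding source by simp
qed

text \<open>Induction from the inputs upwards: \<open>\<sigma>\<close> maps the children of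
  \<open>g\<close> bijectively to those of \<open>\<sigma> g\<close>, so the parities agree.\<close>

lemma gate_value_Aut: "gate_value C a (\<sigma> g) = gate_value C (a \<circ> \<sigma>) g"
proof (induction g rule: wf_induct_rule[OF wf_wires])
  case (1 g)
  let ?X = "{h. (g, h) \<in> wires C \<and> gate_value C (a \<circ> \<sigma>) h}"
  have "{h. (\<sigma> g, h) \<in> wires C \<and> gate_value C a h} = \<sigma> ` ?X"
  proof (intro equalityI subsetI)
    fix h
    assume h: "h \<in> {h. (\<sigma> g, h) \<in> wires C \<and> gate_value C a h}"
    obtain h' where h': "h = \<sigma> h'" by (rule Aut_surj)
    then have "h' \<in> ?X" using h 1 Aut_wire_iff by (auto simp del: comp_apply)
    then show "h \<in> \<sigma> ` ?X" using h' by blast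
  qed (use 1 Aut_wire_iff in \<open>auto simp del: comp_apply\<close>)
  then have "card {h. (\<sigma> g, h) \<in> wires C \<and> gate_value C a h} = card ?X"
    using Aut_bij[OF \<sigma>] by (simp add: card_image inj_on_subset[OF bij_is_inj])
  then show ?case
    by (subst (1 2) gate_value_unfold[OF circuit]) (simp add: Aut_input_gate_iff)
qed

end

section \<open>Extensions of hypercube automorphisms and stabilizers of gates\<close>

lemma extends_to_comp:
  assumes "extends_to C \<pi> \<sigma>" and "extends_to C \<pi>' \<sigma>'"
  shows "extends_to C (\<pi> \<circ> \<pi>') (\<sigma> \<circ> \<sigma>')"
  using assms Aut_input_gate_iff[of \<sigma>']
  by (simp add: extends_to_def Aut_comp image_comp)

lemma extends_to_inv:
  assumes "extends_to C \<pi> \<sigma>" and "bij \<pi>"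
  shows "extends_to C (inv \<pi>) (inv \<sigma>)"
proof -
  have \<sigma>: "\<sigma> \<in> Aut (dag C)" using assms(1) by (simp add: extends_to_def)
  have "label C (inv \<sigma> g) = inv \<pi> ` label C g" if "g \<in> input_gates C" for g
  proof -
    have g: "\<sigma> (inv \<sigma> g) = g" using Aut_bij[OF \<sigma>] by (simp add: bij_is_surj surj_f_inv_f)
    then have "inv \<sigma> g \<in> input_gates C" using that Aut_input_gate_iff[OF \<sigma>] by metis
    then have "label C g = \<pi> ` label C (inv \<sigma> g)"
      using assms(1) g by (auto simp: extends_to_def)
    then show ?thesis using assms(2) by (simp add: bij_is_inj image_comp)
  qed
  then show ?thesis using Aut_inv[OF \<sigma>] by (simp add: extends_to_def)
qed

lemma extends_to_id: "extends_to C id id"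
  by (simp add: extends_to_def Aut_id)

lemma extends_to_funpow:
  assumes "extends_to C \<pi> \<sigma>"
  shows "extends_to C (\<pi> ^^ t) (\<sigma> ^^ t)"
proof (induction t)
  case 0
  then show ?case using extends_to_id by (simp add: id_def)
next
  case (Suc t)
  then show ?case using extends_to_comp[OF assms Suc] by (simp add: comp_def)
qed

text \<open>
  Only the first \<open>m\<close> of the \<open>Suc m\<close> coordinates are flipped; the last one is the direction of
  \<open>base_edge m\<close>.
\<close>

definition flip_stabilizer :: "'g \<Rightarrow> nat set set" where
  "flip_stabilizer g = {A. A \<subseteq> {..<m} \<and> (\<exists>\<sigma>. extends_to C (flip_bits (Suc m) A) \<sigma> \<and> \<sigma> g = g)}"

lemma finite_flip_stabilizer: "finite (flip_stabilizer g)"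
  by (rule finite_subset[of _ "Pow {..<m}"]) (auto simp: flip_stabilizer_def)

lemma flip_stabilizer_empty: "{} \<in> flip_stabilizer g"
  using extends_to_id by (auto simp: flip_stabilizer_def flip_bits_empty intro!: exI[of _ id])

lemma flip_stabilizer_sym_diff:
  assumes "A \<in> flip_stabilizer g" and "B \<in> flip_stabilizer g"
  shows "sym_diff A B \<in> flip_stabilizer g"
proof -
  obtain \<sigma> \<sigma>' where "extends_to C (flip_bits (Suc m) A) \<sigma>" "\<sigma> g = g"
      "extends_to C (flip_bits (Suc m) B) \<sigma>'" "\<sigma>' g = g"
    using assms by (auto simp: flip_stabilizer_def)
  then have "extends_to C (flip_bits (Suc m) (sym_diff A B)) (\<sigma> \<circ> \<sigma>')" "(\<sigma> \<circ> \<sigma>') g = g"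
    using extends_to_comp by (fastforce simp: flip_bits_comp[symmetric])+
  then show ?thesis using assms unfolding flip_stabilizer_def by blast
qed

text \<open>Conjugating by \<open>\<sigma>\<close> an extension that fixes \<open>g\<close> yields
  another one that fixes \<open>g\<close>, and it extends the conjugated flip.\<close>

lemma flip_stabilizer_permute:
  assumes \<rho>: "\<rho> permutes {..<m}" and \<sigma>: "extends_to C (permute_bits (Suc m) \<rho>) \<sigma>" "\<sigma> g = g"
    and A: "A \<in> flip_stabilizer g"
  shows "\<rho> -` A \<in> flip_stabilizer g"
proof -
  let ?n = "Suc m"
  have \<rho>': "\<rho> permutes {..<?n}" using \<rho> by (rule permutes_subset) auto
  obtain \<sigma>' where \<sigma>': "extends_to C (flip_bits ?n A) \<sigma>'" "\<sigma>' g = g"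
    using A by (auto simp: flip_stabilizer_def)
  have bij: "bij (permute_bits ?n \<rho>)" by (rule Aut_bij[OF permute_bits_Aut[OF \<rho>']])
  have "extends_to C (permute_bits ?n \<rho> \<circ> flip_bits ?n A \<circ> inv (permute_bits ?n \<rho>)) (\<sigma> \<circ> \<sigma>' \<circ> inv \<sigma>)"
    by (intro extends_to_comp extends_to_inv \<sigma> \<sigma>' bij)
  moreover have "permute_bits ?n \<rho> \<circ> flip_bits ?n A \<circ> inv (permute_bits ?n \<rho>) = flip_bits ?n (\<rho> -` A)"
    using bij by (simp add: permute_bits_flip_bits[OF \<rho>'] comp_assoc bij_is_surj surj_iff[THEN iffD1])
  moreover have "inv \<sigma> g = g"
    using \<sigma> by (metis Aut_bij bij_inv_eq_iff extends_to_def)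
  moreover have "\<rho> -` A \<subseteq> {..<m}"
    using A permutes_in_image[OF \<rho>] by (auto simp: flip_stabilizer_def)
  ultimately show ?thesis using \<sigma>(2) \<sigma>'(2)
    unfolding flip_stabilizer_def by (auto intro!: exI[of _ "\<sigma> \<circ> \<sigma>' \<circ> inv \<sigma>"])
qed

text \<open>As the only gate without parents, the root is fixed by every circuit
  automorphism.\<close>

lemma flip_stabilizer_root: "flip_stabilizer (root C) = Pow {..<m}"
proof -
  have "\<exists>\<sigma>. extends_to C (flip_bits (Suc m) A) \<sigma> \<and> \<sigma> (root C) = root C" for A
    using symmetric[OF flip_bits_Aut] Aut_root by (metis extends_to_def)
  then show ?thesis by (auto simp: flip_stabilizer_def)
qed

text \<open>An extension fixing \<open>e\<close> keeps its label, so the flip preserves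
  \<open>base_edge m\<close>.\<close>

lemma flip_stabilizer_base_leaf:
  assumes "e \<in> input_gates C" and "label C e = base_edge m"
  shows "flip_stabilizer e = {{}}"
proof -
  have "A = {}" if "A \<in> flip_stabilizer e" for A
  proof -
    obtain \<sigma> where "A \<subseteq> {..<m}" "extends_to C (flip_bits (Suc m) A) \<sigma>" "\<sigma> e = e"
      using \<open>A \<in> flip_stabilizer e\<close> by (auto simp: flip_stabilizer_def)
    then show ?thesis using assms by (intro flip_bits_base_edge[of A m]) (simp, metis extends_to_def)
  qed
  then show ?thesis using flip_stabilizer_empty by blast
qed

text \<open>This is an orbit-stabilizer count. Extensions need not be unique, so one is chosen for
  each flip, and the flips are sorted by the image of \<open>h\<close>.\<close>

lemma card_flip_stabilizer_le:
  assumes "(g, h) \<in> wires C"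
  shows "card (flip_stabilizer g) \<le> card (orbit_fixing (Suc m) C g h) * card (flip_stabilizer h)"
proof -
  let ?n = "Suc m"
  let ?O = "orbit_fixing ?n C g h"
  have "?O \<subseteq> gates C"
    using wire_gates[OF assms] Aut_gate_iff by (auto simp: orbit_fixing_def extends_to_def)
  then have fin: "finite ?O" using finite_gates by (rule finite_subset)
  have "\<forall>A\<in>flip_stabilizer g. \<exists>\<sigma>. extends_to C (flip_bits ?n A) \<sigma> \<and> \<sigma> g = g"
    by (simp add: flip_stabilizer_def)
  then obtain s where s: "\<And>A. A \<in> flip_stabilizer g \<Longrightarrow> extends_to C (flip_bits ?n A) (s A) \<and> s A g = g"
    by metis
  define fib where "fib y = {A \<in> flip_stabilizer g. s A h = y}" for y
  have "s A h \<in> ?O" if "A \<in> flip_stabilizer g" for A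
    using s[OF that] flip_bits_Aut unfolding orbit_fixing_def by blast
  then have cover: "flip_stabilizer g \<subseteq> (\<Union>y\<in>?O. fib y)" by (auto simp: fib_def)
  have "card (fib y) \<le> card (flip_stabilizer h)" for y
  proof (cases "fib y = {}")
    case False
    then obtain B where B: "B \<in> flip_stabilizer g" "s B h = y" by (auto simp: fib_def)
    \<comment> \<open>Two chosen extensions that agree on \<open>h\<close> differ by an automorphism
      fixing \<open>h\<close>, so adding \<open>B\<close> embeds the fibre into
      \<open>flip_stabilizer h\<close>.\<close>
    have "sym_diff B A \<in> flip_stabilizer h" if A: "A \<in> fib y" for A
    proof -
      have A': "A \<in> flip_stabilizer g" "s A h = y" using A by (auto simp: fib_def)
      have "extends_to C (inv (flip_bits ?n B) \<circ> flip_bits ?n A) (inv (s B) \<circ> s A)"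
        using s[OF A'(1)] s[OF B(1)] by (intro extends_to_comp extends_to_inv Aut_bij[OF flip_bits_Aut]) auto
      then have "extends_to C (flip_bits ?n (sym_diff B A)) (inv (s B) \<circ> s A)"
        by (simp add: inv_flip_bits flip_bits_comp)
      moreover have "inv (s B) (s A h) = h"
        using s[OF B(1)] A'(2) B(2) by (metis Aut_bij bij_inv_eq_iff extends_to_def)
      moreover have "sym_diff B A \<subseteq> {..<m}"
        using A'(1) B(1) by (auto simp: flip_stabilizer_def)
      ultimately show ?thesis unfolding flip_stabilizer_def by auto
    qed
    moreover have "inj_on (sym_diff B) (fib y)"
      by (rule inj_onI) blast
    ultimately show ?thesis
      by (intro card_inj_on_le[of "sym_diff B"] finite_flip_stabilizer) auto
  qed simp
  then have "(\<Sum>y\<in>?O. card (fib y)) \<le> card ?O * card (flip_stabilizer h)"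
    using sum_bounded_above[of ?O "\<lambda>y. card (fib y)"] by simp
  moreover have "card (flip_stabilizer g) \<le> card (\<Union>y\<in>?O. fib y)"
    using cover fin finite_flip_stabilizer by (intro card_mono) (auto simp: fib_def)
  moreover have "card (\<Union>y\<in>?O. fib y) \<le> (\<Sum>y\<in>?O. card (fib y))"
    using fin by (rule card_UN_le)
  ultimately show ?thesis by linarith
qed

section \<open>Dependence of gates on a single input\<close>

lemma gate_value_False: "\<not> gate_value C (\<lambda>_. False) g"
proof (induction g rule: wf_induct_rule[OF wf_wires])
  case (1 g)
  then have none: "{h. (g, h) \<in> wires C \<and> gate_value C (\<lambda>_. False) h} = {}" by auto
  show ?case by (subst gate_value_unfold[OF circuit]) (simp add: none)
qed

text \<open>All gates are \<open>False\<close> under the zero assignment, so sensitivity makes the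
  root true under the indicator of \<open>s\<close>. Edge transitivity moves \<open>s\<close> to the
  base edge while the root stays fixed.\<close>

lemma sensitive_base_leaf:
  assumes "sensitive_to C s"
  obtains e where "e \<in> input_gates C" and "label C e = base_edge m"
    and "gate_value C (\<lambda>x. x = e) (root C)"
proof -
  have s: "s \<in> input_gates C" using assms by (simp add: sensitive_to_def)
  have "circuit_output C ((\<lambda>_. False)(s := True)) \<noteq> circuit_output C (\<lambda>_. False)"
    using assms unfolding sensitive_to_def by (metis (full_types))
  moreover have "(\<lambda>_. False)(s := True) = (\<lambda>x. x = s)" by (simp add: fun_eq_iff)
  ultimately have root: "gate_value C (\<lambda>x. x = s) (root C)"
    by (simp add: circuit_output_def gate_value_False)
  have "label C s \<in> graph_edges (hypercube (Suc m))"
    using circuit s by (auto simp: xor_circuit_def)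
  then obtain \<pi> where \<pi>: "\<pi> \<in> Aut (hypercube (Suc m))" "\<pi> ` label C s = base_edge m"
    by (rule hypercube_edge_transitive)
  then obtain \<sigma> where ext: "extends_to C \<pi> \<sigma>" using symmetric by blast
  then have \<sigma>: "\<sigma> \<in> Aut (dag C)" by (simp add: extends_to_def)
  have "(\<lambda>x. x = \<sigma> s) \<circ> \<sigma> = (\<lambda>x. x = s)"
    using Aut_bij[OF \<sigma>] by (auto simp: fun_eq_iff bij_def inj_eq)
  then have "gate_value C (\<lambda>x. x = \<sigma> s) (root C)"
    using root gate_value_Aut[OF \<sigma>, of "\<lambda>x. x = \<sigma> s" "root C"] by (simp add: Aut_root[OF \<sigma>])
  moreover have "label C (\<sigma> s) = base_edge m" using ext s \<pi>(2) by (simp add: extends_to_def)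
  moreover have "\<sigma> s \<in> input_gates C" using s Aut_input_gate_iff[OF \<sigma>] by simp
  ultimately show ?thesis using that by blast
qed

text \<open>Any extension is raised to a power that removes the odd part of its order; the exponent
  is 1 modulo \<open>m\<close>, so the rotation itself does not change.\<close>

lemma two_power_rotation:
  assumes "m = 2 ^ k"
  obtains \<sigma> a where "extends_to C (permute_bits (Suc m) (cyc_shift m)) \<sigma>" and "\<sigma> ^^ (2 ^ a) = id"
proof -
  let ?\<tau> = "permute_bits (Suc m) (cyc_shift m)"
  have perm: "cyc_shift m permutes {..<Suc m}"
    using cyc_shift_permutes by (rule permutes_subset) auto
  obtain \<sigma> where \<sigma>: "extends_to C ?\<tau> \<sigma>" using symmetric[OF permute_bits_Aut[OF perm]] by blast
  then have "permutation \<sigma>"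
    using finite_gates Aut_permutes_gates by (auto simp: extends_to_def permutation_permutes)
  then obtain s where "\<sigma> ^^ s = id" "s > 0" by (rule permutation_is_nilpotent)
  then obtain r a where r: "\<exists>x. r = 1 + 2 ^ k * x" and a: "(\<sigma> ^^ r) ^^ (2 ^ a) = id"
    by (rule power_with_two_power_order)
  from r obtain x where x: "r = Suc (m * x)" using assms by auto
  have "?\<tau> ^^ m = id"
    by (simp add: funpow_permute_bits[OF perm] cyc_shift_funpow_self permute_bits_id)
  then have "?\<tau> ^^ r = ?\<tau>"
    unfolding x by (simp add: funpow_mult[symmetric])
  then have "extends_to C ?\<tau> (\<sigma> ^^ r)"
    using extends_to_funpow[OF \<sigma>, of r] by simp
  then show ?thesis using a by (rule that)
qed

text \<open>
  The set of children of \<open>g\<close> that depend on \<open>e\<close> has odd cardinality and is permuted by \<open>\<sigma>\<close>.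
\<close>

lemma fixed_sensitive_child:
  assumes \<sigma>: "\<sigma> \<in> Aut (dag C)" "\<sigma> ^^ (2 ^ a) = id" "\<sigma> e = e" "\<sigma> g = g"
    and g: "gate_value C (\<lambda>x. x = e) g" "g \<notin> input_gates C"
  shows "\<exists>h. (g, h) \<in> wires C \<and> \<sigma> h = h \<and> gate_value C (\<lambda>x. x = e) h"
proof -
  let ?X = "{h. (g, h) \<in> wires C \<and> gate_value C (\<lambda>x. x = e) h}"
  have "odd (card ?X)"
    using g gate_value_unfold[OF circuit, of "\<lambda>x. x = e" g] by simp
  moreover have "?X \<subseteq> gates C" using wire_gates by blast
  then have "finite ?X" using finite_gates by (rule finite_subset)
  moreover have "\<sigma> ` ?X \<subseteq> ?X"
  proof -
    \<comment> \<open>As \<open>\<sigma>\<close> fixes \<open>e\<close>, the indicator assignment of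
      \<open>e\<close> is invariant, hence so is dependence on \<open>e\<close>.\<close>
    have "\<sigma> x = e \<longleftrightarrow> x = e" for x
      using Aut_bij[OF \<sigma>(1)] \<sigma>(3) by (metis bij_is_inj inj_eq)
    then have "gate_value C (\<lambda>x. x = e) (\<sigma> h) = gate_value C (\<lambda>x. x = e) h" for h
      using gate_value_Aut[OF \<sigma>(1), of "\<lambda>x. x = e" h] by (simp add: comp_def)
    moreover have "(g, \<sigma> h) \<in> wires C \<longleftrightarrow> (g, h) \<in> wires C" for h
      using Aut_wire_iff[OF \<sigma>(1), of g h] \<sigma>(4) by simp
    ultimately show ?thesis by auto
  qed
  ultimately have "\<exists>h\<in>?X. \<sigma> h = h"
    using \<sigma>(2) by (intro odd_card_fixpoint[of ?X \<sigma> a]) auto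
  then show ?thesis by blast
qed

theorem fact_le_card_gates:
  assumes m: "m = 4 * q" and q: "q = 2 ^ k" and sens: "sensitive_to C s"
    and orbits: "\<And>g h. (g, h) \<in> wires C \<Longrightarrow> card (orbit_fixing (Suc m) C g h) \<le> 2 ^ q"
  shows "fact (2 * q) \<le> card (gates C)"
proof -
  let ?n = "Suc m"
  obtain e where e: "e \<in> input_gates C" "label C e = base_edge m"
    and root: "gate_value C (\<lambda>x. x = e) (root C)"
    using sens by (rule sensitive_base_leaf)
  have "m = 2 ^ (k + 2)" using m q by simp
  then obtain \<sigma> a where ext: "extends_to C (permute_bits ?n (cyc_shift m)) \<sigma>" and a: "\<sigma> ^^ (2 ^ a) = id"
    by (rule two_power_rotation)
  have \<sigma>: "\<sigma> \<in> Aut (dag C)" using ext by (simp add: extends_to_def)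
  \<comment> \<open>The rotation preserves the base edge, and labels are injective on
    leaves.\<close>
  have "label C (\<sigma> e) = label C e"
    using ext e by (simp add: extends_to_def permute_bits_base_edge[OF cyc_shift_permutes])
  moreover have "\<sigma> e \<in> input_gates C" using e Aut_input_gate_iff[OF \<sigma>] by simp
  moreover have "inj_on (label C) (input_gates C)" using circuit by (simp add: xor_circuit_def)
  ultimately have \<sigma>e: "\<sigma> e = e" using e(1) by (auto dest: inj_onD)
  \<comment> \<open>A wire costs at most a factor \<open>2 ^ q\<close>, so the descent cannot jump
    from above \<open>2 ^ (2 * q)\<close> to \<open>2 ^ q\<close> or less. It stops before the leaf
    \<open>e\<close>, where the cardinality is 1.\<close>
  have descend: "\<exists>h\<in>gates C. \<sigma> h = h \<and> 2 ^ q < card (flip_stabilizer h) \<and> card (flip_stabilizer h) \<le> 2 ^ (2 * q)"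
    if "g \<in> gates C" "\<sigma> g = g" "gate_value C (\<lambda>x. x = e) g" "2 ^ q < card (flip_stabilizer g)" for g
    using that
  proof (induction g rule: wf_induct_rule[OF wf_wires])
    case (1 g)
    show ?case
    proof (cases "card (flip_stabilizer g) \<le> 2 ^ (2 * q)")
      case False
      have "g \<notin> input_gates C"
      proof
        assume "g \<in> input_gates C"
        then have "g = e" using 1(4) gate_value_unfold[OF circuit, of "\<lambda>x. x = e" g] by simp
        then have "card (flip_stabilizer g) = 1" using flip_stabilizer_base_leaf[OF e] by simp
        then show False using 1(5) by simp
      qed
      then obtain h where h: "(g, h) \<in> wires C" "\<sigma> h = h" "gate_value C (\<lambda>x. x = e) h"
        using fixed_sensitive_child[OF \<sigma> a \<sigma>e] 1 by blast
      have "2 ^ q < card (flip_stabilizer h)"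
      proof (rule ccontr)
        assume "\<not> ?thesis"
        then have "card (orbit_fixing ?n C g h) * card (flip_stabilizer h) \<le> 2 ^ q * 2 ^ q"
          using orbits[OF h(1)] by (intro mult_le_mono) auto
        then have "card (flip_stabilizer g) \<le> 2 ^ q * 2 ^ q"
          using card_flip_stabilizer_le[OF h(1)] by linarith
        then show False using False by (simp add: mult_2 power_add)
      qed
      then show ?thesis using 1(1)[of h] h wire_gates by blast
    qed (use 1 in blast)
  qed
  have "2 ^ q < card (flip_stabilizer (root C))"
    unfolding flip_stabilizer_root using m q by (simp add: card_Pow)
  then obtain g where g: "g \<in> gates C" "\<sigma> g = g"
    and card: "2 ^ q < card (flip_stabilizer g)" "card (flip_stabilizer g) \<le> 2 ^ (2 * q)"
    using descend[OF root_gate Aut_root[OF \<sigma>] root] by blast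
  interpret rotation_invariant_space m "flip_stabilizer g"
    using flip_stabilizer_empty flip_stabilizer_sym_diff
      flip_stabilizer_permute[OF cyc_shift_permutes ext g(2)]
    by unfold_locales (auto simp: flip_stabilizer_def)
  let ?P = "{\<rho>. \<rho> permutes {2 * q..<m}}"
  have P: "\<rho> permutes {..<m}" "\<rho> permutes {..<?n}" if "\<rho> \<in> ?P" for \<rho>
    using that by (auto intro: permutes_subset)
  have "\<forall>\<rho>\<in>?P. \<exists>\<sigma>. extends_to C (permute_bits ?n \<rho>) \<sigma>"
    using symmetric permute_bits_Aut P by blast
  then obtain S where S: "\<And>\<rho>. \<rho> \<in> ?P \<Longrightarrow> extends_to C (permute_bits ?n \<rho>) (S \<rho>)"
    by metis
  \<comment> \<open>If two permutations send \<open>g\<close> to the same gate, their quotient has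
    an extension fixing \<open>g\<close>. It then preserves \<open>flip_stabilizer g\<close> and
    must be the identity.\<close>
  have "inj_on (\<lambda>\<rho>. S \<rho> g) ?P"
  proof (rule inj_onI)
    fix \<rho> \<rho>'
    assume \<rho>: "\<rho> \<in> ?P" and \<rho>': "\<rho>' \<in> ?P" and eq: "S \<rho> g = S \<rho>' g"
    have "extends_to C (inv (permute_bits ?n \<rho>) \<circ> permute_bits ?n \<rho>') (inv (S \<rho>) \<circ> S \<rho>')"
      using S[OF \<rho>] S[OF \<rho>'] by (intro extends_to_comp extends_to_inv Aut_bij[OF permute_bits_Aut] P[OF \<rho>])
    then have ext': "extends_to C (permute_bits ?n (\<rho>' \<circ> inv \<rho>)) (inv (S \<rho>) \<circ> S \<rho>')"
      using P[OF \<rho>] by (simp add: inv_permute_bits permute_bits_comp permutes_inv)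
    have fix_g: "(inv (S \<rho>) \<circ> S \<rho>') g = g"
      using eq S[OF \<rho>] by (metis Aut_bij bij_inv_eq_iff comp_apply extends_to_def)
    have comp: "\<rho>' \<circ> inv \<rho> permutes {2 * q..<m}"
      using \<rho> \<rho>' by (intro permutes_compose permutes_inv) auto
    then have "\<rho>' \<circ> inv \<rho> permutes {..<m}" using P(1) by blast
    then have "\<rho>' \<circ> inv \<rho> = id"
      by (rule upper_half_stabilizer_trivial[OF m q card comp flip_stabilizer_permute[OF _ ext' fix_g]])
    then show "\<rho> = \<rho>'"
      using \<rho> by (metis comp_assoc comp_id fun.map_id id_comp mem_Collect_eq permutes_inv_o(2))
  qed
  moreover have "(\<lambda>\<rho>. S \<rho> g) ` ?P \<subseteq> gates C"
    using S g(1) Aut_gate_iff by (auto simp: extends_to_def)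
  ultimately have "card ?P \<le> card (gates C)"
    using finite_gates by (rule card_inj_on_le)
  moreover have "card ?P = fact (2 * q)"
    using m by (intro card_permutations) auto
  ultimately show ?thesis by simp
qed

end


section \<open>Treewidth and growth\<close>

text \<open>It shows that some width exists, so the \<open>LEAST\<close> in \<open>treewidth\<close>
  is attained.\<close>

lemma single_bag_decomposition:
  assumes "pair_wf_digraph G"
  shows "tree_decomposition G \<lparr>pverts = {0 :: nat}, parcs = {}\<rparr> (\<lambda>_. pverts G)"
proof -
  let ?T = "\<lparr>pverts = {0 :: nat}, parcs = {}\<rparr>"
  have graph: "pair_graph ?T"
    by unfold_locales (auto simp: symmetric_def sym_def arcs_ends_def)
  have conn: "Digraph_Component.connected H" if "verts H = {0 :: nat}" for H :: "(nat, nat \<times> nat) pre_digraph"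
    using that by (simp add: Digraph_Component.connected_def strongly_connected_def reachable_def)
  have "\<not> pre_digraph.cycle (with_proj ?T) p" for p
    by (auto simp: pre_digraph.cycle_def pre_digraph.awalk_def)
  then have "undirected_tree ?T"
    using graph conn by (auto simp: undirected_tree_def)
  moreover have "e \<subseteq> pverts G" if "e \<in> graph_edges G" for e
    using that assms by (force simp: graph_edges_def pair_wf_digraph_def)
  moreover have "Digraph_Component.connected (with_proj ?T \<restriction> {t \<in> pverts ?T. v \<in> pverts G})"
    if "v \<in> pverts G" for v
    using that by (intro conn) auto
  ultimately show ?thesis
    by (simp add: tree_decomposition_def)
qed

text \<open>Some bag of an optimal decomposition contains both ends of the edge.\<close>

lemma treewidth_pos:
  assumes "pair_wf_digraph G" and "finite (pverts G)" and "(u, v) \<in> parcs G" and "u \<noteq> v"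
  shows "0 < treewidth G"
proof -
  have "\<exists>w (T :: nat pair_pre_digraph) bag. tree_decomposition G T bag \<and> decomposition_width T bag = w"
    using single_bag_decomposition[OF assms(1)] by blast
  from LeastI_ex[OF this] obtain T :: "nat pair_pre_digraph" and bag
    where T: "tree_decomposition G T bag" "decomposition_width T bag = treewidth G"
    unfolding treewidth_def by blast
  have "finite (pverts T)"
    using T(1) by (auto simp: tree_decomposition_def undirected_tree_def pair_graph_def pair_digraph_def
        pair_fin_digraph_def pair_fin_digraph_axioms_def)
  have "{u, v} \<in> graph_edges G" using assms(3) by (auto simp: graph_edges_def)
  then obtain t where t: "t \<in> pverts T" "{u, v} \<subseteq> bag t"
    using T(1) unfolding tree_decomposition_def by blast
  have "bag t \<subseteq> pverts G" using T(1) t(1) by (auto simp: tree_decomposition_def)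
  then have "finite (bag t)" using assms(2) by (rule finite_subset)
  then have "2 \<le> card (bag t)" using t(2) assms(4) card_mono[of "bag t" "{u, v}"] by simp
  also have "card (bag t) \<le> Max ((\<lambda>t. card (bag t)) ` pverts T)"
    using t(1) \<open>finite (pverts T)\<close> by (intro Max_ge) auto
  finally show ?thesis using T(2) by (simp add: decomposition_width_def)
qed

lemma treewidth_hypercube_pos: "0 < treewidth (hypercube (Suc m))"
proof (rule treewidth_pos)
  let ?u = "replicate (Suc m) False"
  let ?v = "?u[m := True]"
  have "{i. i < length ?u \<and> ?u ! i \<noteq> ?v ! i} = {m}"
    by (auto simp: nth_list_update simp del: replicate_Suc split: if_splits)
  then have "hamming_dist ?u ?v = 1" by (simp add: hamming_dist_def del: replicate_Suc)
  then show "(?u, ?v) \<in> parcs (hypercube (Suc m))"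
    by (simp add: hypercube_def del: replicate_Suc)
  have "?u ! m \<noteq> ?v ! m" by (simp del: replicate_Suc)
  then show "?u \<noteq> ?v" by metis
  show "pair_wf_digraph (hypercube (Suc m))"
    by unfold_locales (auto simp: hypercube_def)
  show "finite (pverts (hypercube (Suc m)))"
    using finite_lists_length_eq[of "UNIV :: bool set" "Suc m"] by (simp add: hypercube_def)
qed

section \<open>Polynomials in \<open>cfi_size\<close> against factorials\<close>

lemma poly_le_power:
  fixes p :: "real poly"
  shows "\<exists>B>0. \<forall>x\<ge>1. poly p x \<le> B * x ^ degree p"
proof (intro exI conjI allI impI)
  \<comment> \<open>The summand 1 keeps the constant positive for the zero polynomial.\<close>
  let ?B = "1 + (\<Sum>i\<le>degree p. \<bar>coeff p i\<bar>)"
  show "0 < ?B" by (intro add_pos_nonneg sum_nonneg) auto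
  fix x :: real
  assume x: "1 \<le> x"
  have "poly p x = (\<Sum>i\<le>degree p. coeff p i * x ^ i)" by (rule poly_altdef)
  also have "\<dots> \<le> (\<Sum>i\<le>degree p. \<bar>coeff p i\<bar> * x ^ degree p)"
    using x by (intro sum_mono mult_mono power_increasing) auto
  also have "\<dots> = (\<Sum>i\<le>degree p. \<bar>coeff p i\<bar>) * x ^ degree p" by (simp add: sum_distrib_right)
  also have "\<dots> \<le> ?B * x ^ degree p" using x by (intro mult_right_mono) auto
  finally show "poly p x \<le> ?B * x ^ degree p" .
qed

lemma cfi_size_le: "cfi_size n \<le> 8 ^ n"
proof (cases n)
  case 0
  then show ?thesis by (simp add: cfi_size_def)
next
  case (Suc l)
  have n: "n \<le> 2 ^ n" by (rule less_imp_le[OF less_exp])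
  have "(2 :: nat) ^ (2 * n - 1) \<le> 2 ^ (2 * n)" by (intro power_increasing) auto
  also have "\<dots> = 4 ^ n" by (simp add: power_mult)
  finally have "(2 :: nat) ^ (2 * n - 1) \<le> 4 ^ n" .
  moreover have "n * 2 ^ n \<le> 4 ^ n"
    using mult_right_mono[OF n, of "2 ^ n"] by (simp flip: power_mult_distrib)
  \<comment> \<open>Absorbing the factor 2 into \<open>2 ^ n\<close> needs
    \<open>n > 0\<close>.\<close>
  moreover have "(2 :: nat) * 4 ^ n \<le> 8 ^ n"
  proof -
    have "(2 :: nat) * 4 ^ n \<le> 2 ^ n * 4 ^ n" using Suc by simp
    then show ?thesis by (simp flip: power_mult_distrib)
  qed
  ultimately show ?thesis unfolding cfi_size_def by linarith
qed

lemma cfi_size_ge_1: "1 \<le> cfi_size n"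
  by (simp add: cfi_size_def Suc_le_eq)

lemma log_cfi_size_le: "log 2 (real (cfi_size n)) \<le> 3 * real n"
proof -
  have "real (cfi_size n) \<le> 8 ^ n"
    using cfi_size_le[of n] by (metis of_nat_le_iff of_nat_numeral of_nat_power)
  also have "(8 :: real) ^ n = 2 ^ (3 * n)" by (simp add: power_mult)
  finally have "log 2 (real (cfi_size n)) \<le> log 2 (2 ^ (3 * n))"
    using cfi_size_ge_1[of n] by (intro log_mono) auto
  then show ?thesis by (simp add: log_nat_power)
qed

text \<open>It brings the logarithmic orbit bound at \<open>n = Suc (4 * q)\<close> below the factor
  \<open>2 ^ q\<close> allowed per wire.\<close>

lemma eventually_exp_dominates_linear:
  "\<forall>\<^sub>F q in sequentially. K * (3 * real (Suc (4 * q))) \<le> 2 ^ q"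
  by real_asymp

lemma eventually_fact_dominates_poly:
  fixes p :: "real poly"
  shows "\<forall>\<^sub>F q in sequentially. poly p (real (cfi_size (Suc (4 * q)))) < fact (2 * q)"
proof -
  obtain B where B: "B > 0" "\<And>x. x \<ge> 1 \<Longrightarrow> poly p x \<le> B * x ^ degree p"
    using poly_le_power[of p] by blast
  define d where "d = degree p"
  \<comment> \<open>Since \<open>8 ^ (4 * q) = 64 ^ (2 * q)\<close>, the \<open>d\<close>-th power
    of the size is at most \<open>8 ^ d * c ^ (2 * q)\<close>. The terms of the exponential series
    at \<open>c\<close> tend to 0, so the factorial wins.\<close>
  define c where "c = (64 :: real) ^ d"
  have "(\<lambda>n. c ^ n / fact n) \<longlonglongrightarrow> 0"
    using summable_LIMSEQ_zero[OF summable_exp[of c]] by (simp add: field_simps)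
  then have "\<forall>\<^sub>F n in sequentially. c ^ n / fact n < 1 / (B * 8 ^ d)"
    using B(1) by (intro order_tendstoD) auto
  moreover have "filterlim (\<lambda>q :: nat. 2 * q) sequentially sequentially"
    by (rule filterlim_subseq) (auto simp: strict_mono_def)
  ultimately have "\<forall>\<^sub>F q in sequentially. c ^ (2 * q) / fact (2 * q) < 1 / (B * 8 ^ d)"
    by (rule eventually_compose_filterlim)
  then show ?thesis
  proof eventually_elim
    case (elim q)
    let ?N = "real (cfi_size (Suc (4 * q)))"
    have "?N \<le> 8 ^ Suc (4 * q)"
      using cfi_size_le[of "Suc (4 * q)"] by (metis of_nat_le_iff of_nat_numeral of_nat_power)
    then have "?N ^ d \<le> (8 ^ Suc (4 * q)) ^ d" by (intro power_mono) auto
    also have "(8 ^ Suc (4 * q)) ^ d = 8 ^ d * c ^ (2 * q)"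
    proof -
      have "(8 :: real) ^ (4 * q) = 64 ^ (2 * q)" by (simp add: power_mult)
      then show ?thesis by (simp add: c_def power_mult_distrib flip: power_mult)
    qed
    finally have N: "?N ^ d \<le> 8 ^ d * c ^ (2 * q)" .
    have "poly p ?N \<le> B * ?N ^ d"
      using B(2)[of ?N] cfi_size_ge_1[of "Suc (4 * q)"] by (simp add: d_def)
    also have "\<dots> \<le> B * (8 ^ d * c ^ (2 * q))"
      using N B(1) by simp
    also have "\<dots> < fact (2 * q)"
      using elim B(1) by (simp add: field_simps)
    finally show ?case .
  qed
qed

theorem theorem1p2:
  shows "\<not> (\<exists>C :: nat \<Rightarrow> 'g circuit.
    (\<forall>n\<ge>1. xor_circuit n (C n)) \<and>
    (\<exists>p :: real poly. \<forall>n\<ge>1. real (card (gates (C n))) \<le> poly p (real (cfi_size n))) \<and>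
    (\<forall>n\<ge>1. \<forall>\<pi> \<in> Aut (hypercube n). \<exists>\<sigma>. extends_to (C n) \<pi> \<sigma>) \<and>
    (\<exists>c>0. \<forall>\<^sub>F n in sequentially.
       c * real (treewidth (hypercube n)) \<le> real (card {g. sensitive_to (C n) g})) \<and>
    (\<exists>K :: real. \<forall>\<^sub>F n in sequentially. \<forall>g h. (h, g) \<in> wires (C n) \<longrightarrow>
       real (card (orbit_fixing n (C n) h g)) \<le> K * log 2 (real (cfi_size n)) \<and>
       real (card (orbit_fixing n (C n) g h)) \<le> K * log 2 (real (cfi_size n))))"
proof (rule notI, elim exE conjE)
  fix C :: "nat \<Rightarrow> 'g circuit" and p :: "real poly" and c K :: real
  assume circuit: "\<forall>n\<ge>1. xor_circuit n (C n)"
    and size: "\<forall>n\<ge>1. real (card (gates (C n))) \<le> poly p (real (cfi_size n))"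
    and sym: "\<forall>n\<ge>1. \<forall>\<pi> \<in> Aut (hypercube n). \<exists>\<sigma>. extends_to (C n) \<pi> \<sigma>"
    and c: "c > 0"
    and sens: "\<forall>\<^sub>F n in sequentially.
       c * real (treewidth (hypercube n)) \<le> real (card {g. sensitive_to (C n) g})"
    and orbits: "\<forall>\<^sub>F n in sequentially. \<forall>g h. (h, g) \<in> wires (C n) \<longrightarrow>
       real (card (orbit_fixing n (C n) h g)) \<le> K * log 2 (real (cfi_size n)) \<and>
       real (card (orbit_fixing n (C n) g h)) \<le> K * log 2 (real (cfi_size n))"
  \<comment> \<open>Only \<open>n = 4 * q + 1\<close> is considered. Large powers of two
    \<open>q\<close> are contradictory, so eventually no \<open>q\<close> would be a power of two;
    but these are unbounded.\<close>
  have "filterlim (\<lambda>q :: nat. Suc (4 * q)) sequentially sequentially"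
    by (rule filterlim_subseq) (auto simp: strict_mono_def)
  note ev = eventually_compose_filterlim[OF _ this]
  have "\<forall>\<^sub>F q in sequentially. \<nexists>k. q = 2 ^ k"
    using ev[OF sens] ev[OF orbits] eventually_exp_dominates_linear[of "\<bar>K\<bar>"]
      eventually_fact_dominates_poly[of p]
  proof eventually_elim
    case (elim q)
    let ?n = "Suc (4 * q)"
    interpret symmetric_circuit "4 * q" "C ?n"
      using circuit sym by unfold_locales auto
    show ?case
    proof
      assume "\<exists>k. q = 2 ^ k"
      then obtain k where q: "q = 2 ^ k" ..
      \<comment> \<open>Positive treewidth turns the sensitivity bound into the existence of one
        sensitive input.\<close>
      have "0 < c * real (treewidth (hypercube ?n))"
        using c treewidth_hypercube_pos by simp
      then have "card {g. sensitive_to (C ?n) g} \<noteq> 0" using elim(1) by linarith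
      then obtain s where s: "sensitive_to (C ?n) s" by (metis card.empty empty_Collect_eq)
      have "card (orbit_fixing ?n (C ?n) g h) \<le> 2 ^ q" if "(g, h) \<in> wires (C ?n)" for g h
      proof -
        have log: "0 \<le> log 2 (real (cfi_size ?n))" using cfi_size_ge_1[of ?n] by simp
        have "real (card (orbit_fixing ?n (C ?n) g h)) \<le> K * log 2 (real (cfi_size ?n))"
          using elim(2) that by blast
        \<comment> \<open>\<open>K\<close> may be negative; with a nonnegative factor the logarithm
          can be replaced by its upper bound.\<close>
        also have "\<dots> \<le> \<bar>K\<bar> * log 2 (real (cfi_size ?n))"
          using log by (intro mult_right_mono) auto
        also have "\<dots> \<le> \<bar>K\<bar> * (3 * real ?n)"
          by (intro mult_left_mono log_cfi_size_le) auto
        also have "\<dots> \<le> 2 ^ q" by (rule elim(3))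
        finally show ?thesis by (metis of_nat_le_iff of_nat_numeral of_nat_power)
      qed
      then have "fact (2 * q) \<le> card (gates (C ?n))"
        using q s by (intro fact_le_card_gates) auto
      then have "fact (2 * q) \<le> real (card (gates (C ?n)))"
        by (metis of_nat_fact of_nat_le_iff)
      also have "\<dots> \<le> poly p (real (cfi_size ?n))" using size by simp
      finally show False using elim(4) by simp
    qed
  qed
  then obtain Q :: nat where Q: "\<And>q :: nat. Q \<le> q \<Longrightarrow> \<nexists>k. q = 2 ^ k"
    by (auto simp: eventually_sequentially)
  have "Q \<le> 2 ^ Q" by (rule less_imp_le[OF less_exp])
  then show False using Q by blast
qed

end
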